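(* Let $(\mathfrak{J},\alpha,\omega)$ be a cosymplectic JJ-algebra with product $\cdot$ and Reeb vector $\xi$, let $\mathfrak{h}=\ker(\alpha)$, let $\odot$ be the right-skew-symmetric product associated with the symplectic JJ-algebra $(\mathfrak{h},\omega|_{\mathfrak{h}\times\mathfrak{h}})$, and let $\Psi:\mathfrak{J}\to\mathfrak{J}^*$ be the isomorphism $\Psi(x)=\omega(x,\cdot)+\alpha(x)\alpha(\cdot)$. There exists a product $*$ on the vector space $\mathfrak{J}$ defined by $$\Psi(x*y)(z)=\Psi(x)(y\cdot z)\qquad\text{for all }x,y,z\in\mathfrak{J},$$ and it satisfies: 1. For all $x,y\in\mathfrak{h}$, $x*y=x\odot y+\omega(x,y\cdot\xi)\,\xi$. 2. For all $x\in\mathfrak{J}$, $x*\xi=x\cdot\xi$ and $\xi*x=0$. 3. The algebra $(\mathfrak{J},* )$ is a right-skew-symmetric algebra.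
   Context: All algebras are finite-dimensional over a field $\mathbb{K}$ of characteristic different from $2$ and $3$. A JJ-algebra is a vector space $\mathfrak{J}$ with a commutative bilinear product $\cdot$ satisfying $x\cdot(y\cdot z)+y\cdot(z\cdot x)+z\cdot(x\cdot y)=0$ for all $x,y,z$. An algebra $(A,\star)$ is right-skew-symmetric if $(x,y,z)^{\star}+(x,z,y)^{\star}=0$ for all $x,y,z\in A$, where $(x,y,z)^{\star}:=x\star(y\star z)+(x\star y)\star z$ is the anti-associator. A symplectic JJ-algebra $(\mathfrak{h},\omega)$ is a JJ-algebra with a skew-symmetric non-degenerate bilinear form $\omega$ satisfying $\omega(x\cdot y,z)+\omega(z\cdot x,y)+\omega(y\cdot z,x)=0$ for all $x,y,z\in\mathfrak{h}$; its associated right-skew-symmetric product $\odot$ is the product on $\mathfrak{h}$ determined by $\omega(x\odot y,z)=\omega(x,y\cdot z)$. A cosymplectic structure on a JJ-algebra $(\mathfrak{J},\cdot)$ of dimension $2n+1$ is a pair $(\alpha,\omega)$ with $\alpha$ a linear form and $\omega$ a skew-symmetric bilinear form on $\mathfrak{J}$ such that $\alpha\wedge\omega^n\neq0$, $\alpha(x\cdot y)=0$, and $\omega(x\cdot y,z)+\omega(z\cdot x,y)+\omega(y\cdot z,x)=0$ for all $x,y,z\in\mathfrak{J}$; $(\mathfrak{J},\alpha,\omega)$ is then a cosymplectic JJ-algebra. The condition $\alpha\wedge\omega^n\ne0$ implies that $\Psi$ is a linear isomorphism. The Reeb vector is the unique $\xi\in\mathfrak{J}$ with $\alpha(\xi)=1$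 and $\omega(\xi,\cdot)=0$. For a cosymplectic JJ-algebra, $\mathfrak{h}=\ker(\alpha)$ is an ideal and $(\mathfrak{h},\omega|_{\mathfrak{h}\times\mathfrak{h}})$ is a symplectic JJ-algebra. *)

theory Defs
  imports "HOL-Computational_Algebra.Computational_Algebra"
begin

definition bilinear_map ::
  "('k::field \<Rightarrow> 'v::ab_group_add \<Rightarrow> 'v) \<Rightarrow> ('k \<Rightarrow> 'w::ab_group_add \<Rightarrow> 'w) \<Rightarrow> ('v \<Rightarrow> 'v \<Rightarrow> 'w) \<Rightarrow> bool"
  where "bilinear_map s1 s2 f \<longleftrightarrow>
    (\<forall>x. Vector_Spaces.linear s1 s2 (\<lambda>y. f x y)) \<and> (\<forall>y. Vector_Spaces.linear s1 s2 (\<lambda>x. f x y))"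

text \<open>The underlying vector space is the whole type \<open>'v\<close>; \<open>Basis\<close> only witnesses finite
  dimension.\<close>

locale fd_algebra = finite_dimensional_vector_space scale Basis
  for scale :: "'k::field \<Rightarrow> 'v::ab_group_add \<Rightarrow> 'v" and Basis :: "'v set" +
  fixes prd :: "'v \<Rightarrow> 'v \<Rightarrow> 'v"
  assumes char_neq_2: "CHAR('k) \<noteq> 2"
    and char_neq_3: "CHAR('k) \<noteq> 3"
    and bilinear_prd: "bilinear_map scale scale prd"

locale jj_algebra = fd_algebra +
  assumes prd_commute: "prd x y = prd y x"
    and jacobi: "prd x (prd y z) + prd y (prd z x) + prd z (prd x y) = 0"

definition anti_associator :: "('v::ab_group_add \<Rightarrow> 'v \<Rightarrow> 'v) \<Rightarrow> 'v \<Rightarrow> 'v \<Rightarrow> 'v \<Rightarrow> 'v"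
  where "anti_associator prd x y z = prd x (prd y z) + prd (prd x y) z"

locale right_skew_symmetric_algebra = fd_algebra +
  assumes right_skew_symmetric: "anti_associator prd x y z + anti_associator prd x z y = 0"

text \<open>A \<open>p\<close>-form is represented by its values on lists of \<open>p\<close> vectors. The exterior product is
  the shuffle formula
  \[ (\varphi \wedge \psi)(v_0, \dots, v_{p+q-1})
     = \sum_{S} \mathrm{sgn}(S)\, \varphi(v|_S)\, \psi(v|_{S^c}), \]
  over the \<open>p\<close>-element sets \<open>S\<close> of positions, where \<open>sgn(S)\<close> is the sign of the permutation moving
  the positions in \<open>S\<close> to the front. It involves no division, so it is the product of the
  exterior algebra of the dual space in every characteristic.\<close>

definition wedge ::
  "nat \<Rightarrow> nat \<Rightarrow> ('v list \<Rightarrow> 'k::comm_ring_1) \<Rightarrow> ('v list \<Rightarrow> 'k) \<Rightarrow> 'v list \<Rightarrow> 'k"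
  where "wedge p q \<phi> \<psi> vs =
    (\<Sum>S | S \<subseteq> {..<p + q} \<and> card S = p.
       (-1) ^ card {(i, j). i \<in> S \<and> j \<in> {..<p + q} - S \<and> j < i} *
       \<phi> (nths vs S) * \<psi> (nths vs (- S)))"

primrec wedge_power :: "nat \<Rightarrow> ('v list \<Rightarrow> 'k::comm_ring_1) \<Rightarrow> nat \<Rightarrow> 'v list \<Rightarrow> 'k" where
  "wedge_power p \<phi> 0 = (\<lambda>_. 1)"
| "wedge_power p \<phi> (Suc n) = wedge p (p * n) \<phi> (wedge_power p \<phi> n)"

definition form1 :: "('v \<Rightarrow> 'k) \<Rightarrow> 'v list \<Rightarrow> 'k"
  where "form1 \<alpha> vs = \<alpha> (vs ! 0)"

definition form2 :: "('v \<Rightarrow> 'v \<Rightarrow> 'k) \<Rightarrow> 'v list \<Rightarrow> 'k"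
  where "form2 \<omega> vs = \<omega> (vs ! 0) (vs ! 1)"

locale cosymplectic_jj_algebra = jj_algebra scale Basis prd
  for scale :: "'k::field \<Rightarrow> 'v::ab_group_add \<Rightarrow> 'v" and Basis :: "'v set"
    and prd :: "'v \<Rightarrow> 'v \<Rightarrow> 'v" +
  fixes n :: nat and \<alpha> :: "'v \<Rightarrow> 'k" and \<omega> :: "'v \<Rightarrow> 'v \<Rightarrow> 'k"
  assumes dimension_odd: "dimension = 2 * n + 1"
    and linear_\<alpha>: "Vector_Spaces.linear scale (*) \<alpha>"
    and bilinear_\<omega>: "bilinear_map scale (*) \<omega>"
    and skew_\<omega>: "\<omega> x y = - \<omega> y x"
    and wedge_nonzero:
      "\<exists>vs. length vs = 2 * n + 1 \<and> wedge 1 (2 * n) (form1 \<alpha>) (wedge_power 2 (form2 \<omega>) n) vs \<noteq> 0"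
    and \<alpha>_prd: "\<alpha> (prd x y) = 0"
    and cyclic_\<omega>: "\<omega> (prd x y) z + \<omega> (prd z x) y + \<omega> (prd y z) x = 0"

definition reeb_vector :: "('v \<Rightarrow> 'k::field) \<Rightarrow> ('v \<Rightarrow> 'v \<Rightarrow> 'k) \<Rightarrow> 'v"
  where "reeb_vector \<alpha> \<omega> = (THE \<xi>. \<alpha> \<xi> = 1 \<and> (\<forall>x. \<omega> \<xi> x = 0))"

definition Psi :: "('v \<Rightarrow> 'k::field) \<Rightarrow> ('v \<Rightarrow> 'v \<Rightarrow> 'k) \<Rightarrow> 'v \<Rightarrow> 'v \<Rightarrow> 'k"
  where "Psi \<alpha> \<omega> x = (\<lambda>z. \<omega> x z + \<alpha> x * \<alpha> z)"

text \<open>The product associated with a symplectic JJ-algebra whose underlying space is the subspace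
  \<open>H\<close>; only its values on \<open>H\<close> are meaningful, where they are determined because \<open>\<omega>\<close> is
  non-degenerate on \<open>H\<close>.\<close>

definition symplectic_product ::
  "'v set \<Rightarrow> ('v \<Rightarrow> 'v \<Rightarrow> 'v) \<Rightarrow> ('v \<Rightarrow> 'v \<Rightarrow> 'k::field) \<Rightarrow> 'v \<Rightarrow> 'v \<Rightarrow> 'v"
  where "symplectic_product H prd \<omega> x y = (THE u. u \<in> H \<and> (\<forall>z\<in>H. \<omega> u z = \<omega> x (prd y z)))"

end

theory Submission
  imports Defs "HOL-Combinatorics.Transposition"
begin

text \<open>
  Everything rests on one fact about the volume form \<open>\<alpha> \<and> \<omega>\<^sup>n\<close>: since it is nonzero, \<open>\<omega>\<close> is
  non-degenerate on the hyperplane \<open>\<alpha> = 0\<close> (lemma \<open>\<omega>_nondegenerate_on_kernel\<close>). Indeed, let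
  \<open>x \<noteq> 0\<close> lie in that hyperplane and be \<open>\<omega>\<close>-orthogonal to it. Complete \<open>x\<close> to a basis of the
  hyperplane and add one vector \<open>\<eta>\<close> with \<open>\<alpha> \<eta> \<noteq> 0\<close>. Evaluated on this basis, a term of the shuffle
  formula survives only if \<open>\<alpha>\<close> receives \<open>\<eta>\<close>; then \<open>\<omega>\<^sup>n\<close> receives the vectors of the hyperplane,
  among them \<open>x\<close>, so some factor \<open>\<omega>\<close> is applied to \<open>x\<close> and a vector orthogonal to it. Being
  multilinear and alternating, the volume form then vanishes on all lists of \<open>2n + 1\<close> vectors.
  This argument never divides by \<open>n!\<close>, so it also covers small characteristics.

  Non-degeneracy on the hyperplane gives the rest of the linear algebra. If \<open>\<Psi> x = 0\<close> then
  \<open>0 = \<Psi> x x = (\<alpha> x)\<^sup>2\<close>, hence \<open>\<omega> x = 0\<close> and \<open>x = 0\<close>; by finite dimension every linear form is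
  \<open>\<Psi> x\<close> for a unique \<open>x\<close>. Solving \<open>\<Psi> \<xi> = \<alpha>\<close> gives \<open>(\<alpha> \<xi>)\<^sup>2 = \<alpha> \<xi>\<close>, and \<open>\<alpha> \<xi> = 0\<close> is impossible
  because \<open>\<xi>\<close> would then lie in the hyperplane and be orthogonal to it, hence be zero; so
  \<open>\<alpha> \<xi> = 1\<close> and \<open>\<xi>\<close> is the Reeb vector.
  The product \<open>x * y\<close> is the vector representing \<open>z \<mapsto> \<Psi> x (y \<cdot> z)\<close>, which equals
  \<open>z \<mapsto> \<omega> x (y \<cdot> z)\<close> because \<open>\<alpha>\<close> vanishes on products.

  The algebraic claims follow by applying \<open>\<Psi>\<close> to both sides. For right-skew-symmetry the point is
  that the cyclic identity for \<open>\<omega>\<close> says exactly \<open>y * z + z * y = y \<cdot> z\<close>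
  (lemma \<open>star_symmetrized\<close>). With it, \<open>\<Psi>\<close> of \<open>(x, y, z)\<^sup>* + (x, z, y)\<^sup>*\<close> at \<open>w\<close> becomes
  \<open>\<omega> x ((y \<cdot> z) \<cdot> w + y \<cdot> (z \<cdot> w) + z \<cdot> (y \<cdot> w))\<close>, which is zero by the Jacobi identity.
\<close>

section \<open>Subsequences at complementary positions\<close>

lemma nths_append_Cons:
  "nths (us @ y # ws) A =
     nths us A @ (if length us \<in> A then [y] else []) @ nths ws {j. Suc (j + length us) \<in> A}"
  by (simp add: nths_append nths_Cons)

lemma length_nths_subset:
  assumes "S \<subseteq> {..<length vs}"
  shows "length (nths vs S) = card S"
proof -
  have "{i. i < length vs \<and> i \<in> S} = S" using assms by auto
  then show ?thesis by (simp add: length_nths)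
qed

lemma length_nths_Compl:
  assumes "S \<subseteq> {..<length vs}"
  shows "length (nths vs (- S)) = length vs - card S"
proof -
  have "{i. i < length vs \<and> i \<in> - S} = {..<length vs} - S" by auto
  then show ?thesis
    using assms by (simp add: length_nths card_Diff_subset finite_subset[OF assms])
qed

lemma nths_cong:
  assumes "\<And>j. j < length vs \<Longrightarrow> j \<in> A \<longleftrightarrow> j \<in> B"
  shows "nths vs A = nths vs B"
proof -
  have "filter (\<lambda>p. snd p \<in> A) (zip vs [0..<length vs]) =
      filter (\<lambda>p. snd p \<in> B) (zip vs [0..<length vs])"
    by (rule filter_cong) (use assms in \<open>auto simp: set_zip\<close>)
  then show ?thesis by (simp add: nths_def)
qed

section \<open>Multilinear and alternating forms on lists\<close>

text \<open>A slot is given by splitting the argument list around it. With this encoding \<open>nths\<close>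
  distributes over the split, so a shuffle never requires computing the new index of a slot.\<close>

definition multilinear_form ::
  "('k::field \<Rightarrow> 'v::ab_group_add \<Rightarrow> 'v) \<Rightarrow> nat \<Rightarrow> ('v list \<Rightarrow> 'k) \<Rightarrow> bool"
  where "multilinear_form s p \<phi> \<longleftrightarrow>
    (\<forall>us ws. length us + length ws + 1 = p \<longrightarrow>
      Vector_Spaces.linear s (*) (\<lambda>y. \<phi> (us @ y # ws)))"

text \<open>Only equal neighbours are required to give zero: this is the form of the condition that the
  shuffle product preserves by a short argument. For multilinear forms it implies vanishing on
  all lists with a repetition, as the lemma \<open>not_distinct_eq_0\<close> shows.\<close>

definition alternating :: "nat \<Rightarrow> ('v list \<Rightarrow> 'k::zero) \<Rightarrow> bool"
  where "alternating p \<phi> \<longleftrightarrow>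
    (\<forall>us a ws. length us + length ws + 2 = p \<longrightarrow> \<phi> (us @ a # a # ws) = 0)"

lemma linear_mult_left:
  assumes "Vector_Spaces.linear s (*) f"
  shows "Vector_Spaces.linear s (*) (\<lambda>y. c * f y)"
    and "Vector_Spaces.linear s (*) (\<lambda>y. f y * c)"
  using assms by (auto simp: Vector_Spaces.linear_iff algebra_simps)

lemma linear_sum_functionals:
  fixes s :: "'k::field \<Rightarrow> 'v::ab_group_add \<Rightarrow> 'v"
  assumes "vector_space s" and "\<And>i. i \<in> I \<Longrightarrow> Vector_Spaces.linear s (*) (f i)"
  shows "Vector_Spaces.linear s (*) (\<lambda>y. \<Sum>i\<in>I. f i y)"
proof -
  have "vector_space ((*) :: 'k \<Rightarrow> 'k \<Rightarrow> 'k)"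
    by unfold_locales (simp_all add: algebra_simps)
  with assms show ?thesis
    by (auto simp: Vector_Spaces.linear_iff sum.distrib sum_distrib_left)
qed

text \<open>Polarising the condition on equal neighbours shows that exchanging two neighbours changes the
  sign; such exchanges bring two equal entries next to each other.\<close>

lemma not_distinct_eq_0:
  assumes ml: "multilinear_form s p \<phi>" and alt: "alternating p \<phi>"
    and len: "length vs = p" and nd: "\<not> distinct vs"
  shows "\<phi> vs = 0"
proof -
  have swap: "\<phi> (us @ a # b # ws) = - \<phi> (us @ b # a # ws)"
    if l: "length us + length ws + 2 = p" for us a b ws
  proof -
    have add1: "\<phi> (us @ (x + y) # z # ws) = \<phi> (us @ x # z # ws) + \<phi> (us @ y # z # ws)" for x y z
      using ml[unfolded multilinear_form_def, rule_format, of us "z # ws"] l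
      by (simp add: Vector_Spaces.linear_iff)
    have add2: "\<phi> (us @ z # (x + y) # ws) = \<phi> (us @ z # x # ws) + \<phi> (us @ z # y # ws)" for x y z
      using ml[unfolded multilinear_form_def, rule_format, of "us @ [z]" ws] l
      by (simp add: Vector_Spaces.linear_iff)
    have zero: "\<phi> (us @ x # x # ws) = 0" for x
      using alt l by (auto simp: alternating_def)
    have "0 = \<phi> (us @ (a + b) # (a + b) # ws)" by (simp only: zero)
    also have "\<dots> = \<phi> (us @ a # b # ws) + \<phi> (us @ b # a # ws)"
      unfolding add1 add2 by (simp add: zero)
    finally show ?thesis by (simp add: eq_neg_iff_add_eq_0)
  qed
  have apart: "\<phi> (us @ a # mid @ a # ws) = 0"
    if "length us + length mid + length ws + 2 = p" for us a mid ws
    using that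
  proof (induction mid arbitrary: us)
    case Nil
    then show ?case using alt by (simp add: alternating_def)
  next
    case (Cons m mid)
    have "\<phi> (us @ a # m # (mid @ a # ws)) = - \<phi> (us @ m # a # (mid @ a # ws))"
      by (rule swap) (use Cons.prems in simp)
    also have "\<phi> (us @ m # a # (mid @ a # ws)) = 0"
      using Cons.IH[of "us @ [m]"] Cons.prems by simp
    finally show ?case by simp
  qed
  obtain us a mid ws where "vs = us @ [a] @ mid @ [a] @ ws"
    using not_distinct_decomp[OF nd] by blast
  then show ?thesis using apart[of us mid ws a] len by simp
qed

text \<open>Slots are freed one at a time from left to right: in the list \<open>us @ ws\<close> the entries of \<open>us\<close> are
  arbitrary and those of \<open>ws\<close> still lie in \<open>B\<close>.\<close>

lemma multilinear_form_eq_0: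
  assumes vs: "vector_space s"
    and ml: "multilinear_form s p \<phi>" and sp: "module.span s B = UNIV"
    and zero: "\<And>ws. length ws = p \<Longrightarrow> set ws \<subseteq> B \<Longrightarrow> \<phi> ws = 0"
    and len: "length us = p"
  shows "\<phi> us = 0"
proof -
  interpret vector_space s by fact
  have "\<phi> (us @ ws) = 0" if "length us + length ws = p" "set ws \<subseteq> B" for us ws
    using that
  proof (induction us arbitrary: ws rule: rev_induct)
    case Nil
    then show ?case using zero by simp
  next
    case (snoc y us)
    have lin: "Vector_Spaces.linear s (*) (\<lambda>y. \<phi> (us @ y # ws))"
      using ml snoc.prems by (simp add: multilinear_form_def)
    then interpret Vector_Spaces.linear s "(*)" "\<lambda>y. \<phi> (us @ y # ws)" .
    have "\<phi> (us @ b # ws) = 0" if "b \<in> B" for b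
      using snoc.IH[of "b # ws"] snoc.prems that by simp
    then have "\<phi> (us @ y # ws) = 0"
      using eq_0_on_span[of B y] sp by simp
    then show ?case by simp
  qed
  from this[of us "[]"] len show ?thesis by simp
qed

section \<open>The exterior product preserves multilinear and alternating forms\<close>

text \<open>In each shuffle a given slot belongs to exactly one of the two factors, and the other factor
  does not depend on it.\<close>

lemma multilinear_form_wedge:
  fixes s :: "'k::field \<Rightarrow> 'v::ab_group_add \<Rightarrow> 'v"
  assumes vs: "vector_space s"
    and \<phi>: "multilinear_form s p \<phi>" and \<psi>: "multilinear_form s q \<psi>"
  shows "multilinear_form s (p + q) (wedge p q \<phi> \<psi>)"
  unfolding multilinear_form_def wedge_def
proof (intro allI impI linear_sum_functionals[OF vs])
  fix us ws :: "'v list" and S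
  assume len: "length us + length ws + 1 = p + q"
    and S: "S \<in> {S. S \<subseteq> {..<p + q} \<and> card S = p}"
  have l1: "length (nths (us @ y # ws) S) = p" and l2: "length (nths (us @ y # ws) (- S)) = q" for y
    using S len by (simp_all add: length_nths_subset length_nths_Compl)
  let ?c = "(-1) ^ card {(i, j). i \<in> S \<and> j \<in> {..<p + q} - S \<and> j < i} :: 'k"
  show "Vector_Spaces.linear s (*) (\<lambda>y. ?c * \<phi> (nths (us @ y # ws) S) * \<psi> (nths (us @ y # ws) (- S)))"
  proof (cases "length us \<in> S")
    case True
    then have "Vector_Spaces.linear s (*) (\<lambda>y. \<phi> (nths (us @ y # ws) S))"
      using \<phi> l1 by (simp add: nths_append_Cons multilinear_form_def)
    then have "Vector_Spaces.linear s (*)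
        (\<lambda>y. ?c * \<phi> (nths (us @ y # ws) S) * \<psi> (nths (us @ 0 # ws) (- S)))"
      by (intro linear_mult_left)
    then show ?thesis using True by (simp add: nths_append_Cons)
  next
    case False
    then have "Vector_Spaces.linear s (*) (\<lambda>y. \<psi> (nths (us @ y # ws) (- S)))"
      using \<psi> l2 by (simp add: nths_append_Cons multilinear_form_def)
    then have "Vector_Spaces.linear s (*)
        (\<lambda>y. ?c * \<phi> (nths (us @ 0 # ws) S) * \<psi> (nths (us @ y # ws) (- S)))"
      by (intro linear_mult_left)
    then show ?thesis using False by (simp add: nths_append_Cons)
  qed
qed

text \<open>Exchanging the neighbouring positions \<open>i\<close> and \<open>Suc i\<close> maps inversions to inversions and creates
  the single new one \<open>(Suc i, i)\<close>, so the shuffle sign flips.\<close>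

lemma card_inversions_swap:
  fixes i :: nat
  assumes S: "S \<subseteq> {..<N}" and i: "i \<in> S" "Suc i \<notin> S" and N: "Suc i < N"
  defines "T \<equiv> transpose i (Suc i)"
  shows "card {(a, b). a \<in> T ` S \<and> b \<in> {..<N} - T ` S \<and> b < a} =
    Suc (card {(a, b). a \<in> S \<and> b \<in> {..<N} - S \<and> b < a})"
proof -
  let ?I = "{(a, b). a \<in> S \<and> b \<in> {..<N} - S \<and> b < a}"
  have fin: "finite ?I"
    by (rule finite_subset[of _ "{..<N} \<times> {..<N}"]) (use S in auto)
  have TT: "T (T a) = a" for a by (simp add: T_def)
  have T_i: "T i = Suc i" "T (Suc i) = i" by (simp_all add: T_def)
  have TS: "a \<in> T ` S \<longleftrightarrow> T a \<in> S" for a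
    by (metis TT image_iff)
  have TN: "T a < N \<longleftrightarrow> a < N" for a
    using N by (auto simp: T_def transpose_def)
  have less: "T b < T a \<longleftrightarrow> b < a" if "(a, b) \<noteq> (i, Suc i)" "(a, b) \<noteq> (Suc i, i)" for a b
    using that by (auto simp: T_def transpose_def)
  have "{(a, b). a \<in> T ` S \<and> b \<in> {..<N} - T ` S \<and> b < a} =
    insert (Suc i, i) (map_prod T T ` ?I)" (is "?L = ?R")
  proof (rule set_eqI, clarify)
    fix a b
    have "(a, b) \<in> map_prod T T ` ?I \<longleftrightarrow> (T a, T b) \<in> ?I"
      by (auto simp: TT image_iff) (metis TT)
    then show "(a, b) \<in> ?L \<longleftrightarrow> (a, b) \<in> ?R"
    proof (cases "(a, b) = (Suc i, i) \<or> (a, b) = (i, Suc i)")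
      case True
      then show ?thesis using i N \<open>(a, b) \<in> map_prod T T ` ?I \<longleftrightarrow> _\<close>
        by (elim disjE) (simp_all add: TS T_i)
    next
      case False
      then show ?thesis using less[of a b] \<open>(a, b) \<in> map_prod T T ` ?I \<longleftrightarrow> _\<close>
        by (auto simp: TS TN)
    qed
  qed
  moreover have "(Suc i, i) \<notin> map_prod T T ` ?I"
    by (auto simp: T_def transpose_def split: if_splits)
  moreover have "inj_on (map_prod T T) ?I"
    by (rule inj_on_inverseI[where g = "map_prod T T"]) (auto simp: TT)
  ultimately show ?thesis by (simp only: card_insert_disjoint finite_imageI fin card_image not_False_eq_True)
qed

text \<open>Let the entries at \<open>i\<close> and \<open>Suc i\<close> be equal. A shuffle sending both to the same factor gives
  zero since that factor is alternating. The remaining shuffles come in pairs that differ by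
  exchanging the two positions; they pick the same vectors with opposite signs and cancel. Pairing
  the terms, instead of proving that the sum is its own negative, makes this valid also in
  characteristic two.\<close>

lemma alternating_wedge:
  fixes \<phi> \<psi> :: "'v list \<Rightarrow> 'k::comm_ring_1"
  assumes \<phi>: "alternating p \<phi>" and \<psi>: "alternating q \<psi>"
  shows "alternating (p + q) (wedge p q \<phi> \<psi>)"
  unfolding alternating_def
proof (intro allI impI)
  fix us ws :: "'v list" and a
  assume len: "length us + length ws + 2 = p + q"
  define i where "i = length us"
  define vs where "vs = us @ a # a # ws"
  define T where "T = transpose i (Suc i)"
  define F where "F = {S. S \<subseteq> {..<p + q} \<and> card S = p}"
  define X where "X = {S \<in> F. i \<in> S \<and> Suc i \<notin> S}"
  define Y where "Y = {S \<in> F. i \<notin> S \<and> Suc i \<in> S}"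
  define t where "t S = (-1) ^ card {(i, j). i \<in> S \<and> j \<in> {..<p + q} - S \<and> j < i} *
    \<phi> (nths vs S) * \<psi> (nths vs (- S))" for S
  have N: "Suc i < p + q" and lvs: "length vs = p + q" using len by (auto simp: i_def vs_def)
  have TT: "T (T j) = j" for j by (simp add: T_def)
  have T_mem: "j \<in> T ` S \<longleftrightarrow> T j \<in> S" for j S
    by (metis TT image_iff)
  have nths_vs: "nths vs A = nths us A @ (if i \<in> A then [a] else []) @
      (if Suc i \<in> A then [a] else []) @ nths ws {j. Suc (Suc (j + i)) \<in> A}" for A
    by (simp add: vs_def i_def nths_append nths_Cons)
  have rest: "t S = 0" if S: "S \<in> F" and both: "i \<in> S \<longleftrightarrow> Suc i \<in> S" for S
  proof -
    have l: "length (nths vs S) = p" "length (nths vs (- S)) = q"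
      using S lvs by (simp_all add: F_def length_nths_subset length_nths_Compl)
    show ?thesis
    proof (cases "i \<in> S")
      case True
      then have "\<phi> (nths vs S) = 0"
        using both \<phi> l by (simp add: nths_vs alternating_def)
      then show ?thesis by (simp add: t_def)
    next
      case False
      then have "\<psi> (nths vs (- S)) = 0"
        using both \<psi> l by (simp add: nths_vs alternating_def)
      then show ?thesis by (simp add: t_def)
    qed
  qed
  have T_F: "T ` S \<in> F" if "S \<in> F" for S
  proof -
    have "inj_on T S" by (rule inj_on_inverseI[where g = T]) (simp add: TT)
    moreover have "T ` S \<subseteq> {..<p + q}"
      using that N by (auto simp: F_def T_def transpose_def)
    ultimately show ?thesis using that by (simp add: F_def card_image)
  qed
  have T_i: "T i = Suc i" "T (Suc i) = i" by (simp_all add: T_def)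
  have TT_image: "T ` T ` S = S" for S by (auto simp: image_image TT)
  have XY: "T ` S \<in> Y" if "S \<in> X" for S
    using that by (simp add: X_def Y_def T_F T_mem T_i)
  have YX: "T ` S \<in> X" if "S \<in> Y" for S
    using that by (simp add: X_def Y_def T_F T_mem T_i)
  have bij: "bij_betw ((`) T) X Y"
    by (rule bij_betw_byWitness[where f' = "(`) T"])
       (auto simp: TT_image XY YX)
  have swap: "t (T ` S) = - t S" if "S \<in> X" for S
  proof -
    have S: "S \<subseteq> {..<p + q}" "i \<in> S" "Suc i \<notin> S" using that by (auto simp: X_def F_def)
    have other: "T j = j" if "j \<noteq> i" "j \<noteq> Suc i" for j
      using that by (simp add: T_def)
    have us_eq: "nths us (T ` A) = nths us A" for A
      by (rule nths_cong) (auto simp: T_mem other i_def)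
    have nths_T: "nths vs (T ` A) = nths vs A" if "i \<in> A \<longleftrightarrow> Suc i \<notin> A" for A
      using that by (auto simp: nths_vs us_eq T_mem T_i other)
    have "- (T ` S) = T ` (- S)" by (rule set_eqI) (simp add: T_mem)
    then have "nths vs (- (T ` S)) = nths vs (- S)" using S by (simp add: nths_T)
    moreover have "nths vs (T ` S) = nths vs S" using S by (simp add: nths_T)
    ultimately show ?thesis
      using card_inversions_swap[OF S N] by (simp add: t_def T_def)
  qed
  have fin: "finite F" by (simp add: F_def)
  have "wedge p q \<phi> \<psi> vs = sum t F" by (simp add: wedge_def t_def F_def)
  also have "\<dots> = sum t (X \<union> Y)"
    using rest fin by (intro sum.mono_neutral_right) (auto simp: X_def Y_def)
  also have "\<dots> = sum t X + sum t Y"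
    using fin by (intro sum.union_disjoint) (auto simp: X_def Y_def)
  also have "sum t Y = (\<Sum>S\<in>X. t (T ` S))"
    using sum.reindex_bij_betw[OF bij] by metis
  also have "\<dots> = - sum t X" using swap by (simp add: sum_negf)
  finally show "wedge p q \<phi> \<psi> (us @ a # a # ws) = 0" by (simp add: vs_def)
qed

lemma wedge_power_multilinear_alternating:
  assumes vs: "vector_space s"
    and "multilinear_form s p \<phi>" and "alternating p \<phi>"
  shows "multilinear_form s (p * n) (wedge_power p \<phi> n)"
    and "alternating (p * n) (wedge_power p \<phi> n)"
proof (induction n)
  case 0
  { case 1 show ?case by (simp add: multilinear_form_def) }
  { case 2 show ?case by (simp add: alternating_def) }
next
  case (Suc n)
  { case 1 show ?case using multilinear_form_wedge[OF vs assms(2) Suc(1)] by simp }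
  { case 2 show ?case using alternating_wedge[OF assms(3) Suc(2)] by simp }
qed

text \<open>Each term of \<open>\<omega>\<^sup>n\<close> is a product of values of \<open>\<omega>\<close> that together use every entry, hence contains a
  factor applied to \<open>x\<close>.\<close>

lemma wedge_power_eq_0:
  fixes \<omega> :: "'v \<Rightarrow> 'v \<Rightarrow> 'k::comm_ring_1"
  assumes "length vs = 2 * n" and "x \<in> set vs"
    and "\<And>u. u \<in> set vs \<Longrightarrow> \<omega> x u = 0 \<and> \<omega> u x = 0"
  shows "wedge_power 2 (form2 \<omega>) n vs = 0"
  using assms
proof (induction n arbitrary: vs)
  case 0
  then show ?case by simp
next
  case (Suc n)
  have "form2 \<omega> (nths vs S) * wedge_power 2 (form2 \<omega>) n (nths vs (- S)) = 0"
    if S: "S \<subseteq> {..<2 + 2 * n}" "card S = 2" for S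
  proof -
    have l: "length (nths vs S) = 2" "length (nths vs (- S)) = 2 * n"
      using S Suc.prems(1) by (simp_all add: length_nths_subset length_nths_Compl)
    have sub: "set (nths vs A) \<subseteq> set vs" for A by (rule set_nths_subset)
    have "x \<in> set (nths vs S) \<or> x \<in> set (nths vs (- S))"
      using Suc.prems(2) by (auto simp: set_nths in_set_conv_nth)
    then show ?thesis
    proof
      assume x: "x \<in> set (nths vs S)"
      obtain u w where uw: "nths vs S = [u, w]"
        using l(1) by (auto simp: length_Suc_conv numeral_2_eq_2)
      then have "\<omega> u w = 0" using x sub[of S] Suc.prems(3) by auto
      then show ?thesis by (simp add: uw form2_def)
    next
      assume "x \<in> set (nths vs (- S))"
      then have "wedge_power 2 (form2 \<omega>) n (nths vs (- S)) = 0"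
        using Suc.IH l(2) sub[of "- S"] Suc.prems(3) by blast
      then show ?thesis by simp
    qed
  qed
  then show ?case
    by (auto simp: wedge_def mult.assoc intro!: sum.neutral)
qed

section \<open>Representing functionals by a non-degenerate form\<close>

text \<open>The map \<open>x \<mapsto> f x\<close> into the dual space is injective. Listing the values of a functional on the
  basis as the coordinates of a vector identifies the dual with the space itself, so that the
  theorem on injective endomorphisms applies.\<close>

lemma (in finite_dimensional_vector_space) nondegenerate_form_represents_functional:
  fixes f :: "'b \<Rightarrow> 'b \<Rightarrow> 'a" and g :: "'b \<Rightarrow> 'a"
  assumes f: "bilinear_map scale (*) f"
    and nondeg: "\<And>x. (\<And>z. f x z = 0) \<Longrightarrow> x = 0"
    and g: "Vector_Spaces.linear scale (*) g"
  shows "\<exists>x. \<forall>z. f x z = g z"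
proof -
  have f_left: "f (x + y) z = f x z + f y z" "f (scale c x) z = c * f x z" for x y z c
    using f by (simp_all add: bilinear_map_def Vector_Spaces.linear_iff)
  have f_right: "Vector_Spaces.linear scale (*) (f x)" for x
    using f by (simp add: bilinear_map_def)
  interpret pair: vector_space_pair scale "(*) :: 'a \<Rightarrow> 'a \<Rightarrow> 'a"
    using g by (auto simp: Vector_Spaces.linear_iff vector_space_pair_def)
  define \<Theta> where "\<Theta> x = (\<Sum>b\<in>Basis. scale (f x b) b)" for x
  have coeffs: "h b = h' b"
    if "(\<Sum>b\<in>Basis. scale (h b) b) = (\<Sum>b\<in>Basis. scale (h' b) b)" "b \<in> Basis" for h h' b
  proof -
    have "(\<Sum>b\<in>Basis. scale (h b - h' b) b) = 0"
      using that(1) by (simp add: scale_left_diff_distrib sum_subtractf)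
    from independentD[OF independent_Basis finite_Basis order_refl this that(2)]
    show ?thesis by simp
  qed
  have eq_on_Basis: "f x z = h z"
    if h: "Vector_Spaces.linear scale (*) h" and "\<And>b. b \<in> Basis \<Longrightarrow> f x b = h b" for x h z
    using pair.linear_eq_on_span[OF f_right h that(2)] by (simp add: span_Basis)
  have lin: "Vector_Spaces.linear scale scale \<Theta>"
    by (auto simp: Vector_Spaces.linear_iff \<Theta>_def f_left scale_left_distrib sum.distrib
        scale_sum_right intro: vector_space_axioms)
  interpret endo: Vector_Spaces.linear scale scale \<Theta> by (rule lin)
  have "x = 0" if "\<Theta> x = 0" for x
  proof (rule nondeg, rule eq_on_Basis)
    show "Vector_Spaces.linear scale (*) (\<lambda>_. 0)" by (rule pair.linear_zero)
    show "f x b = 0" if "b \<in> Basis" for b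
      using coeffs[of "f x" "\<lambda>_. 0" b] \<open>\<Theta> x = 0\<close> that by (simp add: \<Theta>_def)
  qed
  then have "inj \<Theta>" by (simp add: endo.inj_iff_eq_0)
  then have "surj \<Theta>" by (rule linear_inj_imp_surj[OF lin])
  then obtain x where "\<Theta> x = (\<Sum>b\<in>Basis. scale (g b) b)" by (metis surjD)
  then have "f x b = g b" if "b \<in> Basis" for b
    using coeffs[of "f x" g b] that by (simp add: \<Theta>_def)
  then show ?thesis using eq_on_Basis[OF g] by blast
qed

section \<open>The volume form and non-degeneracy on the hyperplane\<close>

context cosymplectic_jj_algebra
begin

lemma \<omega>_add: "\<omega> (x + y) z = \<omega> x z + \<omega> y z" "\<omega> x (y + z) = \<omega> x y + \<omega> x z"
  and \<omega>_scale: "\<omega> (scale c x) y = c * \<omega> x y" "\<omega> x (scale c y) = c * \<omega> x y"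
  using bilinear_\<omega> by (simp_all add: bilinear_map_def Vector_Spaces.linear_iff)

lemma \<alpha>_add: "\<alpha> (x + y) = \<alpha> x + \<alpha> y" and \<alpha>_scale: "\<alpha> (scale c x) = c * \<alpha> x"
  using linear_\<alpha> by (simp_all add: Vector_Spaces.linear_iff)

lemma prd_add: "prd (x + y) z = prd x z + prd y z" "prd x (y + z) = prd x y + prd x z"
  and prd_scale: "prd (scale c x) y = scale c (prd x y)" "prd x (scale c y) = scale c (prd x y)"
  using bilinear_prd by (simp_all add: bilinear_map_def Vector_Spaces.linear_iff)

lemma \<omega>_0: "\<omega> 0 x = 0" "\<omega> x 0 = 0"
  using \<omega>_scale(1)[of 0 0 x] \<omega>_scale(2)[of x 0 0] by simp_all

lemma \<alpha>_0: "\<alpha> 0 = 0"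
  using \<alpha>_scale[of 0 0] by simp

lemma \<alpha>_diff: "\<alpha> (x - y) = \<alpha> x - \<alpha> y"
  using \<alpha>_add[of "x - y" y] by simp

lemma \<omega>_diff: "\<omega> (x - y) z = \<omega> x z - \<omega> y z" "\<omega> x (y - z) = \<omega> x y - \<omega> x z"
  using \<omega>_add(1)[of "x - y" y z] \<omega>_add(2)[of x "y - z" z] by simp_all

lemma \<omega>_self: "\<omega> x x = 0"
proof -
  have "CHAR('k) \<noteq> 2" by (rule char_neq_2)
  then have "\<not> CHAR('k) dvd 2"
    using CHAR_not_1[where ?'a = 'k] two_is_prime_nat by (auto simp: prime_nat_iff)
  then have "of_nat 2 \<noteq> (0 :: 'k)" using of_nat_eq_0_iff_char_dvd by blast
  moreover have "of_nat 2 * \<omega> x x = 0"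
    using skew_\<omega>[of x x] by (simp add: eq_neg_iff_add_eq_0)
  ultimately show ?thesis by simp
qed

lemma volume_form_multilinear_alternating:
  defines "\<Phi> \<equiv> wedge 1 (2 * n) (form1 \<alpha>) (wedge_power 2 (form2 \<omega>) n)"
  shows "multilinear_form scale (2 * n + 1) \<Phi>" and "alternating (2 * n + 1) \<Phi>"
proof -
  have 1: "multilinear_form scale 1 (form1 \<alpha>)" "alternating 1 (form1 \<alpha>)"
    using linear_\<alpha> by (auto simp: multilinear_form_def alternating_def form1_def)
  have "multilinear_form scale 2 (form2 \<omega>)"
    unfolding multilinear_form_def
  proof (intro allI impI)
    fix us ws :: "'v list"
    assume "length us + length ws + 1 = 2"
    then consider u where "us = [u]" "ws = []" | w where "us = []" "ws = [w]"
      by (cases us; cases ws) auto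
    then show "Vector_Spaces.linear scale (*) (\<lambda>y. form2 \<omega> (us @ y # ws))"
      using bilinear_\<omega> by cases (auto simp: form2_def bilinear_map_def)
  qed
  moreover have "alternating 2 (form2 \<omega>)"
    by (auto simp: alternating_def form2_def \<omega>_self)
  ultimately have 2: "multilinear_form scale (2 * n) (wedge_power 2 (form2 \<omega>) n)"
    "alternating (2 * n) (wedge_power 2 (form2 \<omega>) n)"
    using wedge_power_multilinear_alternating[OF vector_space_axioms] by blast+
  show "multilinear_form scale (2 * n + 1) \<Phi>" "alternating (2 * n + 1) \<Phi>"
    using multilinear_form_wedge[OF vector_space_axioms 1(1) 2(1)] alternating_wedge[OF 1(2) 2(2)]
    by (simp_all add: \<Phi>_def)
qed

lemma \<alpha>_nonzero: "\<exists>\<eta>. \<alpha> \<eta> \<noteq> 0"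
proof (rule ccontr)
  assume "\<not> ?thesis"
  then have "wedge 1 (2 * n) (form1 \<alpha>) \<psi> vs = 0" for \<psi> vs
    by (simp add: wedge_def form1_def)
  then show False using wedge_nonzero by blast
qed

text \<open>If \<open>x\<close> were a counterexample, the volume form would vanish on a basis adapted to \<open>x\<close> and to the
  hyperplane, and hence everywhere, contrary to \<open>\<alpha> \<and> \<omega>\<^sup>n \<noteq> 0\<close>.\<close>

lemma \<omega>_nondegenerate_on_kernel:
  assumes x: "\<alpha> x = 0" and orth: "\<And>h. \<alpha> h = 0 \<Longrightarrow> \<omega> x h = 0"
  shows "x = 0"
proof (rule ccontr)
  assume "x \<noteq> 0"
  define \<Phi> where "\<Phi> = wedge 1 (2 * n) (form1 \<alpha>) (wedge_power 2 (form2 \<omega>) n)"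
  obtain \<eta> where \<eta>: "\<alpha> \<eta> \<noteq> 0" using \<alpha>_nonzero by blast
  define K where "K = {h. \<alpha> h = 0}"
  have "subspace K" by (simp add: K_def subspace_def \<alpha>_0 \<alpha>_add \<alpha>_scale)
  obtain C where C: "{x} \<subseteq> C" "C \<subseteq> K" "independent C" "K \<subseteq> span C"
    using maximal_independent_subset_extend[of "{x}" K] x \<open>x \<noteq> 0\<close>
    by (auto simp: K_def)
  have "\<eta> \<notin> span C"
    using \<eta> span_minimal[OF C(2) \<open>subspace K\<close>] by (auto simp: K_def)
  then have indep: "independent (insert \<eta> C)" using C(3) by (rule independent_insertI)
  have span: "span (insert \<eta> C) = UNIV"
  proof -
    have "v \<in> span (insert \<eta> C)" for v
    proof -
      have "v - scale (\<alpha> v / \<alpha> \<eta>) \<eta> \<in> span C"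
        using C(4) \<eta> by (auto simp: K_def \<alpha>_diff \<alpha>_scale)
      then show ?thesis by (auto simp: span_insert)
    qed
    then show ?thesis by blast
  qed
  have card: "card (insert \<eta> C) = 2 * n + 1"
    using basis_card_eq_dim[of "insert \<eta> C" UNIV] span indep dimension_odd
    by (simp add: dimension_def)
  \<comment> \<open>A list of \<open>2n + 1\<close> basis vectors has a repetition or exhausts the basis; in the second case
      it contains \<open>x\<close>, and \<open>\<eta>\<close> exactly once.\<close>
  have "\<Phi> ws = 0" if len: "length ws = 2 * n + 1" and sub: "set ws \<subseteq> insert \<eta> C" for ws
  proof (cases "distinct ws")
    case False
    then show ?thesis
      using not_distinct_eq_0 volume_form_multilinear_alternating len unfolding \<Phi>_def by blast
  next
    case True
    then have set: "set ws = insert \<eta> C"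
      using card_subset_eq[OF finiteI_independent[OF indep] sub] card len
      by (simp add: distinct_card)
    have "form1 \<alpha> (nths ws S) * wedge_power 2 (form2 \<omega>) n (nths ws (- S)) = 0"
      if S: "S \<subseteq> {..<1 + 2 * n}" "card S = 1" for S
    proof -
      obtain k where k: "S = {k}" using S(2) by (auto simp: card_1_singleton_iff)
      have kn: "k < length ws" using S len k by simp
      have S1: "length (nths ws S) = 1" "set (nths ws S) = {ws ! k}"
        using S len kn by (auto simp: length_nths_subset set_nths k)
      then have nth: "nths ws S ! 0 = ws ! k"
        by (metis insertI1 length_greater_0_conv less_numeral_extra(1) nth_mem singletonD)
      show ?thesis
      proof (cases "ws ! k = \<eta>")
        case False
        then have "ws ! k \<in> K" using set C(2) kn nth_mem by blast
        then show ?thesis by (simp add: form1_def nth K_def)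
      next
        case True
        have rest: "set (nths ws (- S)) = C"
        proof -
          have "\<eta> \<notin> C" using C(2) \<eta> by (auto simp: K_def)
          moreover have "set (nths ws (- S)) = set ws - {ws ! k}"
            using \<open>distinct ws\<close> kn by (auto simp: set_nths k in_set_conv_nth nth_eq_iff_index_eq)
          ultimately show ?thesis using set True by auto
        qed
        have "wedge_power 2 (form2 \<omega>) n (nths ws (- S)) = 0"
        proof (rule wedge_power_eq_0)
          show "length (nths ws (- S)) = 2 * n" using S len by (simp add: length_nths_Compl)
          show "x \<in> set (nths ws (- S))" using rest C(1) by simp
          show "\<omega> x u = 0 \<and> \<omega> u x = 0" if "u \<in> set (nths ws (- S))" for u
            using that rest C(2) orth[of u] skew_\<omega>[of u x] by (auto simp: K_def)
        qed
        then show ?thesis by simp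
      qed
    qed
    then show ?thesis
      by (auto simp: \<Phi>_def wedge_def mult.assoc intro!: sum.neutral)
  qed
  then have "\<Phi> vs = 0" if "length vs = 2 * n + 1" for vs
    using multilinear_form_eq_0[OF vector_space_axioms _ span _ that]
      volume_form_multilinear_alternating(1) unfolding \<Phi>_def by blast
  then show False using wedge_nonzero by (auto simp: \<Phi>_def)
qed

section \<open>The isomorphism onto the dual and the Reeb vector\<close>

lemma Psi_bilinear: "bilinear_map scale (*) (Psi \<alpha> \<omega>)"
  using linear_\<alpha>
  by (auto simp: bilinear_map_def Psi_def Vector_Spaces.linear_iff \<omega>_add \<omega>_scale \<alpha>_add \<alpha>_scale
      algebra_simps)

lemma Psi_left: "Psi \<alpha> \<omega> (x + y) z = Psi \<alpha> \<omega> x z + Psi \<alpha> \<omega> y z"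
  "Psi \<alpha> \<omega> (scale c x) z = c * Psi \<alpha> \<omega> x z"
  using Psi_bilinear by (simp_all add: bilinear_map_def Vector_Spaces.linear_iff)

lemma Psi_eq_0:
  assumes "\<And>z. Psi \<alpha> \<omega> x z = 0"
  shows "x = 0"
proof -
  have "\<alpha> x = 0" using assms[of x] by (simp add: Psi_def \<omega>_self)
  moreover have "\<omega> x z = 0" for z using assms[of z] \<open>\<alpha> x = 0\<close> by (simp add: Psi_def)
  ultimately show ?thesis by (intro \<omega>_nondegenerate_on_kernel)
qed

lemma Psi_eqD:
  assumes "\<And>z. Psi \<alpha> \<omega> x z = Psi \<alpha> \<omega> y z"
  shows "x = y"
proof -
  have "Psi \<alpha> \<omega> (x - y) z = 0" for z
    using assms[of z] by (simp add: Psi_def \<omega>_diff \<alpha>_diff algebra_simps)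
  then show ?thesis using Psi_eq_0 by fastforce
qed

lemma Psi_represents:
  assumes "Vector_Spaces.linear scale (*) g"
  shows "\<exists>x. \<forall>z. Psi \<alpha> \<omega> x z = g z"
  using nondegenerate_form_represents_functional[OF Psi_bilinear Psi_eq_0 assms] by blast

text \<open>The Reeb vector is the one that \<open>\<Psi>\<close> sends to \<open>\<alpha>\<close>. Bijectivity of \<open>\<Psi>\<close> alone would not suffice
  here: for \<open>\<alpha> = e\<^sub>1\<close> and \<open>\<omega> = e\<^sub>1 \<and> e\<^sub>2\<close> on a plane, \<open>\<Psi>\<close> is bijective, but the vector sent to \<open>\<alpha>\<close>
  lies in the kernel of \<open>\<alpha>\<close>. Non-degeneracy on the hyperplane excludes this.\<close>

lemma reeb_vector:
  shows "\<alpha> (reeb_vector \<alpha> \<omega>) = 1" and "\<omega> (reeb_vector \<alpha> \<omega>) x = 0"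
proof -
  obtain \<xi> where \<xi>: "\<And>z. \<omega> \<xi> z + \<alpha> \<xi> * \<alpha> z = \<alpha> z"
    using Psi_represents[OF linear_\<alpha>] by (auto simp: Psi_def)
  have "\<alpha> \<xi> * (\<alpha> \<xi> - 1) = 0" using \<xi>[of \<xi>] by (simp add: \<omega>_self algebra_simps)
  moreover have "\<alpha> \<xi> \<noteq> 0"
  proof
    assume 0: "\<alpha> \<xi> = 0"
    then have "\<xi> = 0"
      using \<xi> by (intro \<omega>_nondegenerate_on_kernel) (metis add.right_neutral mult_zero_left)+
    then show False using \<xi> \<alpha>_nonzero by (auto simp: \<omega>_0 \<alpha>_0)
  qed
  ultimately have 1: "\<alpha> \<xi> = 1" by simp
  have 2: "\<omega> \<xi> z = 0" for z using \<xi>[of z] 1 by simp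
  have "reeb_vector \<alpha> \<omega> = \<xi>"
    unfolding reeb_vector_def
  proof (rule the_equality)
    show "\<alpha> \<xi> = 1 \<and> (\<forall>z. \<omega> \<xi> z = 0)" using 1 2 by simp
    show "\<xi>' = \<xi>" if "\<alpha> \<xi>' = 1 \<and> (\<forall>z. \<omega> \<xi>' z = 0)" for \<xi>'
      by (rule Psi_eqD) (use that 1 2 in \<open>simp add: Psi_def\<close>)
  qed
  then show "\<alpha> (reeb_vector \<alpha> \<omega>) = 1" "\<omega> (reeb_vector \<alpha> \<omega>) x = 0" using 1 2 by simp_all
qed

section \<open>The product and its identities\<close>

definition star :: "'v \<Rightarrow> 'v \<Rightarrow> 'v"
  where "star x y = (SOME u. \<forall>z. Psi \<alpha> \<omega> u z = Psi \<alpha> \<omega> x (prd y z))"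

lemma Psi_star: "Psi \<alpha> \<omega> (star x y) z = Psi \<alpha> \<omega> x (prd y z)"
proof -
  have "Vector_Spaces.linear scale (*) (\<lambda>z. Psi \<alpha> \<omega> x (prd y z))"
    using Psi_bilinear
    by (auto simp: bilinear_map_def Vector_Spaces.linear_iff prd_add prd_scale)
  from someI_ex[OF Psi_represents[OF this]] show ?thesis by (simp add: star_def)
qed

lemma Psi_star_eq: "Psi \<alpha> \<omega> (star x y) z = \<omega> x (prd y z)"
  by (simp add: Psi_star) (simp add: Psi_def \<alpha>_prd)

lemma star_bilinear: "bilinear_map scale scale star"
proof -
  have "star (x + y) z = star x z + star y z" "star x (y + z) = star x y + star x z"
    "star (scale c x) y = scale c (star x y)" "star x (scale c y) = scale c (star x y)" for x y z c
    by (rule Psi_eqD, simp add: Psi_left Psi_star_eq \<omega>_add \<omega>_scale prd_add prd_scale)+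
  then show ?thesis
    using vector_space_axioms by (simp add: bilinear_map_def Vector_Spaces.linear_iff)
qed

text \<open>In the cyclic identity for \<open>x\<close>, \<open>\<xi>\<close>, \<open>z\<close> the term pairing \<open>z \<cdot> x\<close> with \<open>\<xi>\<close> drops out, so
  multiplication by \<open>\<xi>\<close> is self-adjoint for \<open>\<omega>\<close>.\<close>

lemma star_reeb_vector:
  "star x (reeb_vector \<alpha> \<omega>) = prd x (reeb_vector \<alpha> \<omega>)"
  "star (reeb_vector \<alpha> \<omega>) x = 0"
proof -
  let ?\<xi> = "reeb_vector \<alpha> \<omega>"
  have "\<omega> (prd x ?\<xi>) z = \<omega> x (prd ?\<xi> z)" for z
    using cyclic_\<omega>[of x ?\<xi> z] skew_\<omega>[of "prd z x" ?\<xi>] skew_\<omega>[of x "prd ?\<xi> z"]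
    by (simp add: reeb_vector add_eq_0_iff)
  then show "star x ?\<xi> = prd x ?\<xi>"
    by (intro Psi_eqD) (simp add: Psi_star_eq, simp add: Psi_def \<alpha>_prd)
  show "star ?\<xi> x = 0"
    by (intro Psi_eqD) (simp add: Psi_star_eq reeb_vector, simp add: Psi_def \<alpha>_0 \<omega>_0)
qed

text \<open>Evaluating \<open>\<Psi> (x * y)\<close> at \<open>\<xi>\<close> gives \<open>\<alpha> (x * y) = \<omega> x (y \<cdot> \<xi>)\<close>. Subtracting this multiple of \<open>\<xi>\<close>
  moves \<open>x * y\<close> into the hyperplane without changing its pairing with vectors there, and those
  pairings characterise the symplectic product.\<close>

lemma star_on_kernel:
  assumes "\<alpha> x = 0" and "\<alpha> y = 0"
  defines "\<xi> \<equiv> reeb_vector \<alpha> \<omega>"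
  shows "star x y = symplectic_product {h. \<alpha> h = 0} prd \<omega> x y + scale (\<omega> x (prd y \<xi>)) \<xi>"
proof -
  define u where "u = star x y - scale (\<omega> x (prd y \<xi>)) \<xi>"
  have \<xi>: "\<alpha> \<xi> = 1" "\<omega> \<xi> z = 0" "\<omega> z \<xi> = 0" for z
    using reeb_vector skew_\<omega>[of z \<xi>] by (simp_all add: \<xi>_def)
  have star: "\<omega> (star x y) z + \<alpha> (star x y) * \<alpha> z = \<omega> x (prd y z)" for z
    using Psi_star_eq[of x y z] by (simp add: Psi_def)
  have "\<alpha> (star x y) = \<omega> x (prd y \<xi>)" using star[of \<xi>] by (simp add: \<xi>)
  then have u: "\<alpha> u = 0" by (simp add: u_def \<alpha>_diff \<alpha>_scale \<xi>)
  have \<omega>u: "\<omega> u z = \<omega> x (prd y z)" if "\<alpha> z = 0" for z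
    using star[of z] that by (simp add: u_def \<omega>_diff \<omega>_scale \<xi>)
  have "symplectic_product {h. \<alpha> h = 0} prd \<omega> x y = u"
    unfolding symplectic_product_def
  proof (rule the_equality)
    show "u \<in> {h. \<alpha> h = 0} \<and> (\<forall>z\<in>{h. \<alpha> h = 0}. \<omega> u z = \<omega> x (prd y z))"
      using u \<omega>u by simp
    fix v assume "v \<in> {h. \<alpha> h = 0} \<and> (\<forall>z\<in>{h. \<alpha> h = 0}. \<omega> v z = \<omega> x (prd y z))"
    then have "v - u = 0"
      using u \<omega>u by (intro \<omega>_nondegenerate_on_kernel) (simp_all add: \<alpha>_diff \<omega>_diff)
    then show "v = u" by simp
  qed
  then show ?thesis by (simp add: u_def)
qed

text \<open>This is the cyclic identity for \<open>\<omega>\<close>, read through \<open>\<Psi>\<close>.\<close>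

lemma star_symmetrized: "star y z + star z y = prd y z"
proof (rule Psi_eqD)
  fix w
  have "Psi \<alpha> \<omega> (star y z + star z y) w = \<omega> y (prd z w) + \<omega> z (prd y w)"
    by (simp add: Psi_left Psi_star_eq)
  also have "\<dots> = \<omega> (prd y z) w"
    using cyclic_\<omega>[of y z w] skew_\<omega>[of "prd w y" z] skew_\<omega>[of "prd z w" y] prd_commute[of w y]
    by (simp add: algebra_simps)
  also have "\<dots> = Psi \<alpha> \<omega> (prd y z) w" by (simp add: Psi_def \<alpha>_prd)
  finally show "Psi \<alpha> \<omega> (star y z + star z y) w = Psi \<alpha> \<omega> (prd y z) w" .
qed

text \<open>Under \<open>\<Psi>\<close> the nested product \<open>(x * a) * b\<close> becomes \<open>w \<mapsto> \<omega> x (a \<cdot> (b \<cdot> w))\<close>, because the defining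
  property of \<open>*\<close> can be used twice. Symmetrising in \<open>a\<close> and \<open>b\<close> leaves the Jacobi sum.\<close>

lemma star_right_skew_symmetric: "anti_associator star x y z + anti_associator star x z y = 0"
proof (rule Psi_eq_0)
  fix w
  have anti: "Psi \<alpha> \<omega> (anti_associator star x a b) w =
      \<omega> x (prd (star a b) w) + \<omega> x (prd a (prd b w))" for a b
  proof -
    have "\<omega> (star x a) (prd b w) = \<omega> x (prd a (prd b w))"
      using Psi_star_eq[of x a "prd b w"] by (simp add: Psi_def \<alpha>_prd)
    then show ?thesis by (simp add: anti_associator_def Psi_left Psi_star_eq)
  qed
  have "Psi \<alpha> \<omega> (anti_associator star x y z + anti_associator star x z y) w =
      \<omega> x (prd (star y z + star z y) w + prd y (prd z w) + prd z (prd y w))"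
    by (simp add: Psi_left anti \<omega>_add prd_add algebra_simps)
  also have "prd (star y z + star z y) w + prd y (prd z w) + prd z (prd y w) = 0"
    using jacobi[of y z w] by (simp add: star_symmetrized prd_commute algebra_simps)
  finally show "Psi \<alpha> \<omega> (anti_associator star x y z + anti_associator star x z y) w = 0"
    by (simp add: \<omega>_0)
qed

end

theorem proposition3p1:
  fixes scale :: "'k::field \<Rightarrow> 'v::ab_group_add \<Rightarrow> 'v" and Basis :: "'v set"
    and prd :: "'v \<Rightarrow> 'v \<Rightarrow> 'v" and n :: nat
    and \<alpha> :: "'v \<Rightarrow> 'k" and \<omega> :: "'v \<Rightarrow> 'v \<Rightarrow> 'k"
    and \<xi> :: 'v and H :: "'v set" and odot :: "'v \<Rightarrow> 'v \<Rightarrow> 'v"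
  assumes "cosymplectic_jj_algebra scale Basis prd n \<alpha> \<omega>"
    and "\<xi> = reeb_vector \<alpha> \<omega>"
    and "H = {x. \<alpha> x = 0}"
    and "odot = symplectic_product H prd \<omega>"
  shows "\<exists>star :: 'v \<Rightarrow> 'v \<Rightarrow> 'v.
      bilinear_map scale scale star \<and>
      (\<forall>x y z. Psi \<alpha> \<omega> (star x y) z = Psi \<alpha> \<omega> x (prd y z)) \<and>
      (\<forall>star'. (\<forall>x y z. Psi \<alpha> \<omega> (star' x y) z = Psi \<alpha> \<omega> x (prd y z)) \<longrightarrow> star' = star) \<and>
      (\<forall>x\<in>H. \<forall>y\<in>H. star x y = odot x y + scale (\<omega> x (prd y \<xi>)) \<xi>) \<and>
      (\<forall>x. star x \<xi> = prd x \<xi> \<and> star \<xi> x = 0) \<and>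
      right_skew_symmetric_algebra scale Basis star"
proof -
  interpret cosymplectic_jj_algebra scale Basis prd n \<alpha> \<omega> by fact
  have "star' = star" if "\<forall>x y z. Psi \<alpha> \<omega> (star' x y) z = Psi \<alpha> \<omega> x (prd y z)" for star'
    by (intro ext Psi_eqD) (simp add: that Psi_star)
  moreover have "right_skew_symmetric_algebra scale Basis star"
    by unfold_locales (use char_neq_2 char_neq_3 star_bilinear star_right_skew_symmetric in auto)
  ultimately show ?thesis
    using star_bilinear Psi_star star_on_kernel star_reeb_vector assms(2-4)
    by (intro exI[of _ star]) auto
qed

end
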